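(* Let $G$ be a graph and $F_1,F_2\in M(\mathcal{G})$. The product of $Z_{F_1}$ and $Z_{F_2}$ in $H(\mathcal{G})^{\ast}$ is given by $$Z_{F_1}Z_{F_2}=\sum_{F\in M(\mathcal{G})}n(F_1,F_2;F)\,Z_F,$$ where $n(F_1,F_2;F)$ is the number of occurrences of $F_1\otimes F_2$ in $\Delta_G(F)$.
   Context: $\mathbf{k}$ is a unitary commutative ring; tensor products and linear maps are over $\mathbf{k}$. Graphs are finite, connected, undirected, without multiple edges and loops (induced subgraphs of them may be disconnected). $G$ is a graph whose vertices are labelled by distinct natural numbers. $\mathcal{G}$ is the set of nonempty connected subgraphs of $G$ (a subgraph is a graph all of whose vertices lie in $V(G)$ and all of whose edges lie in $E(G)$). $M(\mathcal{G})$ is the free (noncommutative) monoid on $\mathcal{G}$, with multiplication given by concatenation and unit the empty graph $\mathbf{1}$. $H(\mathcal{G})=\mathbf{k}M(\mathcal{G})$ is the free $\mathbf{k}$-module on $M(\mathcal{G})$, with multiplication extended linearly. For $\Gamma\in\mathcal{G}$ and $U\subseteq V(\Gamma)$, $\Gamma[U]$ is the subgraph of $\Gamma$ induced by $U$, viewed as an element of $M(\mathcal{G})$: it is the product of its connected components, written in increasing order of their smallest labels, and $\Gamma[\emptyset]=\mathbf{1}$. The coproduct $\Delta_G:H(\mathcal{G})\to H(\mathcal{G})\otimes H(\mathcal{G})$ is the linear map given for $F=\Gamma_1\cdots\Gamma_n\in M(\mathcal{G})$, $\Gamma_i\in\mathcal{G}$, by $$\Delta_G(F)=\sum_{U_i\sqcup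 V_i=V(\Gamma_i),\ i=1,\dots,n}\Gamma_1[U_1]\cdots\Gamma_n[U_n]\otimes\Gamma_1[V_1]\cdots\Gamma_n[V_n],$$ with $\Delta_G(\mathbf{1})=\mathbf{1}\otimes\mathbf{1}$. The number of occurrences of $F_1\otimes F_2$ in $\Delta_G(F)$ is the number of terms of this sum equal to $F_1\otimes F_2$. For $F=\Gamma_1\cdots\Gamma_m$ let $|V(F)|=\sum_i|V(\Gamma_i)|$ and let $H(\mathcal{G})^{(n)}$ be the $\mathbf{k}$-span of all $F\in M(\mathcal{G})$ with $|V(F)|=n$; it has finite rank. The graded dual is $H(\mathcal{G})^{\ast}=\bigoplus_{n\ge0}(H(\mathcal{G})^{(n)})^{\ast}$. For $F\in M(\mathcal{G})$, $Z_F:H(\mathcal{G})\to\mathbf{k}$ is the linear map with $Z_F(F')=\delta_{F,F'}$ for $F'\in M(\mathcal{G})$; the $Z_F$ form a basis of $H(\mathcal{G})^{\ast}$. The product on $H(\mathcal{G})^{\ast}$ is the dual $\Delta_G^{\ast}$ of the coproduct: $(\alpha\beta)(x)=(\alpha\otimes\beta)(\Delta_G(x))$ for $\alpha,\beta\in H(\mathcal{G})^{\ast}$, $x\in H(\mathcal{G})$. *)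

theory Defs
  imports
    "HOL-Library.Poly_Mapping"
    "HOL-Library.FuncSet"
    "Graph_Theory.Digraph_Component"
begin

section \<open>The monoid of words in connected subgraphs\<close>

text \<open>
  As in the Graph_Theory library, an undirected simple graph is a finite loop-free symmetric
  digraph without parallel arcs (locale \<open>graph\<close>); an edge is a pair of mutually opposite arcs.
  Hence a subgraph in the undirected sense is a sub-digraph that is itself a \<open>graph\<close>.
  Note that \<open>connected\<close> fails for the graph without vertices.
\<close>

type_synonym 'b lgraph = "(nat, 'b) pre_digraph"
type_synonym 'b word = "'b lgraph list"

definition connected_subgraphs :: "'b lgraph \<Rightarrow> 'b lgraph set" where
  "connected_subgraphs G = {\<Gamma>. subgraph \<Gamma> G \<and> graph \<Gamma> \<and> connected \<Gamma>}"

text \<open>The free monoid on the connected subgraphs: concatenation is \<open>@\<close>, the unit is \<open>[]\<close>.\<close>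

definition words :: "'b lgraph \<Rightarrow> 'b word set" where
  "words G = lists (connected_subgraphs G)"

definition word_order :: "'b word \<Rightarrow> nat" where
  "word_order F = (\<Sum>\<Gamma>\<leftarrow>F. card (verts \<Gamma>))"

definition components :: "'b lgraph \<Rightarrow> 'b lgraph set" where
  "components H = {C. pre_digraph.max_subgraph H connected C}"

definition min_label :: "'b lgraph \<Rightarrow> nat" where
  "min_label C = Min (verts C)"

text \<open>
  The subgraph of \<open>\<Gamma>\<close> induced by \<open>U\<close>, as a word: its connected components, by increasing
  smallest label (see \<open>induced_word_components\<close> below).
\<close>

definition induced_word :: "'b lgraph \<Rightarrow> nat set \<Rightarrow> 'b word" where
  "induced_word \<Gamma> U =
    map (inv_into (components (\<Gamma> \<restriction> U)) min_label)
      (sorted_list_of_set (min_label ` components (\<Gamma> \<restriction> U)))"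


section \<open>The coproduct\<close>

text \<open>
  An element of the free module on words is a finitely supported function on words; the tensor
  square of that module is the free module on pairs of words, the pair \<open>(A, B)\<close> standing for the
  basis element given by the tensor product of \<open>A\<close> and \<open>B\<close>.
\<close>

type_synonym ('b, 'k) word_module = "'b word \<Rightarrow>\<^sub>0 'k"
type_synonym ('b, 'k) word_tensor = "'b word \<times> 'b word \<Rightarrow>\<^sub>0 'k"

definition scale :: "'k::comm_ring_1 \<Rightarrow> ('a \<Rightarrow>\<^sub>0 'k) \<Rightarrow> ('a \<Rightarrow>\<^sub>0 'k)" where
  "scale c x = Poly_Mapping.map ((*) c) x"

definition free_module :: "'b lgraph \<Rightarrow> ('b, 'k::comm_ring_1) word_module set" where
  "free_module G = {x. Poly_Mapping.keys x \<subseteq> words G}"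

definition free_module_degree :: "'b lgraph \<Rightarrow> nat \<Rightarrow> ('b, 'k::comm_ring_1) word_module set" where
  "free_module_degree G n = {x. Poly_Mapping.keys x \<subseteq> {F \<in> words G. word_order F = n}}"

definition vertex_splits :: "'b lgraph \<Rightarrow> (nat set \<times> nat set) set" where
  "vertex_splits \<Gamma> = {(U, V). U \<union> V = verts \<Gamma> \<and> U \<inter> V = {}}"

text \<open>The families of pairs \<open>(U\<^sub>i, V\<^sub>i)\<close> over which the coproduct of a word is summed.\<close>

definition coproduct_indices :: "'b word \<Rightarrow> (nat set \<times> nat set) list set" where
  "coproduct_indices F = listset (map vertex_splits F)"

definition coproduct_term :: "'b word \<Rightarrow> (nat set \<times> nat set) list \<Rightarrow> 'b word \<times> 'b word" where
  "coproduct_term F ps =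
    (concat (map2 (\<lambda>\<Gamma> (U, V). induced_word \<Gamma> U) F ps),
     concat (map2 (\<lambda>\<Gamma> (U, V). induced_word \<Gamma> V) F ps))"

definition coproduct_word :: "'b word \<Rightarrow> ('b, 'k::comm_ring_1) word_tensor" where
  "coproduct_word F =
    (\<Sum>ps\<in>coproduct_indices F. Poly_Mapping.single (coproduct_term F ps) 1)"

definition coproduct :: "('b, 'k::comm_ring_1) word_module \<Rightarrow> ('b, 'k) word_tensor" where
  "coproduct x = (\<Sum>F\<in>Poly_Mapping.keys x. scale (Poly_Mapping.lookup x F) (coproduct_word F))"

definition occurrences :: "'b word \<Rightarrow> 'b word \<Rightarrow> 'b word \<Rightarrow> nat" where
  "occurrences F1 F2 F =
    card {ps \<in> coproduct_indices F. coproduct_term F ps = (F1, F2)}"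


section \<open>The graded dual\<close>

text \<open>
  A linear form on the submodule \<open>free_module G\<close> is represented extensionally, i.e. it is \<open>undefined\<close>
  outside \<open>free_module G\<close>, so that equality of functions is equality of linear forms.
  The direct sum of the duals of the homogeneous parts consists of the linear forms that
  vanish on all but finitely many homogeneous parts.
\<close>

definition linear_forms ::
    "'b lgraph \<Rightarrow> (('b, 'k::comm_ring_1) word_module \<Rightarrow> 'k) set" where
  "linear_forms G = {\<alpha> \<in> extensional (free_module G).
     (\<forall>x\<in>free_module G. \<forall>y\<in>free_module G. \<alpha> (x + y) = \<alpha> x + \<alpha> y) \<and>
     (\<forall>c. \<forall>x\<in>free_module G. \<alpha> (scale c x) = c * \<alpha> x)}"

definition graded_dual ::
    "'b lgraph \<Rightarrow> (('b, 'k::comm_ring_1) word_module \<Rightarrow> 'k) set" where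
  "graded_dual G = {\<alpha> \<in> linear_forms G. finite {n. \<exists>x\<in>free_module_degree G n. \<alpha> x \<noteq> 0}}"

definition dual_basis :: "'b lgraph \<Rightarrow> 'b word \<Rightarrow> ('b, 'k::comm_ring_1) word_module \<Rightarrow> 'k" where
  "dual_basis G F = (\<lambda>x\<in>free_module G. Poly_Mapping.lookup x F)"

definition tensor_form ::
    "(('b, 'k::comm_ring_1) word_module \<Rightarrow> 'k) \<Rightarrow> (('b, 'k) word_module \<Rightarrow> 'k) \<Rightarrow>
     ('b, 'k) word_tensor \<Rightarrow> 'k" where
  "tensor_form \<alpha> \<beta> t =
    (\<Sum>(A, B)\<in>Poly_Mapping.keys t.
       Poly_Mapping.lookup t (A, B) * (\<alpha> (Poly_Mapping.single A 1) * \<beta> (Poly_Mapping.single B 1)))"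

definition dual_mult ::
    "'b lgraph \<Rightarrow> (('b, 'k::comm_ring_1) word_module \<Rightarrow> 'k) \<Rightarrow> (('b, 'k) word_module \<Rightarrow> 'k) \<Rightarrow>
     ('b, 'k) word_module \<Rightarrow> 'k" where
  "dual_mult G \<alpha> \<beta> = (\<lambda>x\<in>free_module G. tensor_form \<alpha> \<beta> (coproduct x))"


section \<open>Adequacy of the definitions\<close>

lemma components_eq_sccs:
  assumes "sym_digraph K"
  shows "components K = pre_digraph.sccs K"
proof -
  interpret K: sym_digraph K by fact
  have strong: "strongly_connected (K \<restriction> verts C)" "subgraph (K \<restriction> verts C) K"
      "subgraph C (K \<restriction> verts C)" "connected (K \<restriction> verts C)"
    if "subgraph C K" "connected C" for C
  proof -
    from that have vs: "verts C \<subseteq> verts K" by auto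
    have ind: "induced_subgraph (K \<restriction> verts C) K" using vs by blast
    then have sym: "symmetric (K \<restriction> verts C)"
      using K.sym_arcs induced_graph_imp_symmetric by blast
    interpret I: wf_digraph "K \<restriction> verts C" by blast
    show "subgraph (K \<restriction> verts C) K" using ind by (rule induced_imp_subgraph)
    show sub: "subgraph C (K \<restriction> verts C)"
      using that(1) I.wf_digraph
      by (auto simp: subgraph_def compatible_def wf_digraph_def)
    show con: "connected (K \<restriction> verts C)"
      by (rule I.connected_spanning_imp_connected[of C])
        (use sub that(2) in \<open>auto simp: spanning_def\<close>)
    show "strongly_connected (K \<restriction> verts C)"
      using I.symmetric_connected_imp_strongly_connected[OF sym con] .
  qed
  have conn: "connected C" if "strongly_connected C" "subgraph C K" for C
  proof -
    from that(2) interpret C: wf_digraph C by auto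
    show ?thesis
    proof (rule C.connectedI)
      show "verts C \<noteq> {}" using that(1) by (auto simp: strongly_connected_def)
      fix u v assume "u \<in> verts C" "v \<in> verts C"
      then have "u \<rightarrow>\<^sup>*\<^bsub>C\<^esub> v" using that(1) by (auto simp: strongly_connected_def)
      then show "u \<rightarrow>\<^sup>*\<^bsub>mk_symmetric C\<^esub> v" by (rule C.reachable_mk_symmetricI)
    qed
  qed
  show ?thesis
  proof (rule set_eqI, rule iffI)
    fix C assume "C \<in> components K"
    then have C: "subgraph C K" "connected C"
      and max: "\<And>C'. C' \<noteq> C \<Longrightarrow> subgraph C C' \<Longrightarrow> subgraph C' K \<Longrightarrow> \<not> connected C'"
      by (auto simp: components_def K.max_subgraph_def)
    have "C = K \<restriction> verts C" using strong[OF C] max by metis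
    then have "strongly_connected C" using strong(1)[OF C] by simp
    then have "K.max_subgraph strongly_connected C"
      using C(1) max conn by (auto simp: K.max_subgraph_def)
    then show "C \<in> K.sccs" by (simp add: K.sccs_altdef2)
  next
    fix C assume sccs: "C \<in> K.sccs"
    then have "K.max_subgraph strongly_connected C" by (simp add: K.sccs_altdef2)
    then have C: "subgraph C K" "strongly_connected C" and ind: "induced_subgraph C K"
      using sccs by (auto simp: K.max_subgraph_def)
    show "C \<in> components K"
      unfolding components_def K.max_subgraph_def mem_Collect_eq
    proof (intro conjI allI impI notI)
      show "subgraph C K" by fact
      show "connected C" using conn C by blast
      fix C' assume C': "C' \<noteq> C \<and> subgraph C C'" "subgraph C' K \<and> connected C'"
      have vs: "verts C \<subseteq> verts C'" using C' by auto
      have s: "strongly_connected (K \<restriction> verts C')" "induced_subgraph (K \<restriction> verts C') K"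
        using strong[of C'] C' by auto
      have "verts C = verts C'"
        using sccs s vs by (metis K.in_sccsE induce_subgraph_verts psubsetI)
      moreover from this have "arcs C' \<subseteq> arcs C"
        using ind C' by (force simp: induced_subgraph_def subgraph_def compatible_def
            dest: wf_digraph.wellformed)
      ultimately have "C' = C" using C' by (auto simp: subgraph_def compatible_def)
      then show False using C' by simp
    qed
  qed
qed

lemma graph_induce: "graph \<Gamma> \<Longrightarrow> U \<subseteq> verts \<Gamma> \<Longrightarrow> graph (\<Gamma> \<restriction> U)"
proof -
  assume g: "graph \<Gamma>" and U: "U \<subseteq> verts \<Gamma>"
  interpret graph \<Gamma> by fact
  have ind: "induced_subgraph (\<Gamma> \<restriction> U) \<Gamma>" using U by blast
  have "finite U" using U finite_verts finite_subset by blast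
  moreover have "symmetric (\<Gamma> \<restriction> U)" using sym_arcs ind by (rule induced_graph_imp_symmetric)
  ultimately show ?thesis
    using no_loops no_multi_arcs by unfold_locales (auto simp: arc_to_ends_def)
qed

lemma components_induce:
  assumes \<Gamma>: "\<Gamma> \<in> connected_subgraphs G" and U: "U \<subseteq> verts \<Gamma>"
  shows "components (\<Gamma> \<restriction> U) \<subseteq> connected_subgraphs G"
    and "finite (components (\<Gamma> \<restriction> U))"
    and "(\<Union>C\<in>components (\<Gamma> \<restriction> U). verts C) = U"
    and "\<And>C D. C \<in> components (\<Gamma> \<restriction> U) \<Longrightarrow> D \<in> components (\<Gamma> \<restriction> U) \<Longrightarrow> C \<noteq> D \<Longrightarrow>
           verts C \<inter> verts D = {}"
    and "inj_on min_label (components (\<Gamma> \<restriction> U))"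
proof -
  let ?K = "\<Gamma> \<restriction> U"
  have g\<Gamma>: "graph \<Gamma>" using \<Gamma> by (simp add: connected_subgraphs_def)
  interpret K: graph ?K using g\<Gamma> U by (rule graph_induce)
  have eq: "components ?K = K.sccs" by (rule components_eq_sccs) unfold_locales
  have sub: "subgraph ?K G"
    using \<Gamma> U K.wf_digraph by (auto simp: connected_subgraphs_def subgraph_def compatible_def)
  show "components ?K \<subseteq> connected_subgraphs G"
  proof
    fix C assume C: "C \<in> components ?K"
    then have c: "connected C" "subgraph C ?K" by (auto simp: components_def K.max_subgraph_def)
    have ind: "induced_subgraph C ?K" using C unfolding eq by auto
    then have "C = ?K \<restriction> verts C" by (metis K.induce_eq_iff_induced subgraphE induced_imp_subgraph)
    moreover have "graph (?K \<restriction> verts C)" 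
      by (rule graph_induce[OF K.graph_axioms]) (use c(2) in \<open>simp add: subgraph_def\<close>)
    ultimately have "graph C" by simp
    moreover have "subgraph C G" using c(2) sub by (rule subgraph_trans)
    ultimately show "C \<in> connected_subgraphs G" using c by (simp add: connected_subgraphs_def)
  qed
  show fin: "finite (components ?K)"
    using K.finite_sccs_verts K.inj_on_verts_sccs
    by (simp add: eq K.sccs_verts_conv finite_image_iff)
  show "(\<Union>C\<in>components ?K. verts C) = U"
  proof -
    have "(\<Union>C\<in>K.sccs. verts C) = verts (K.Union K.sccs)" by (simp add: K.Union_def)
    then show ?thesis by (simp add: eq K.graph_is_union_sccs)
  qed
  show disj: "verts C \<inter> verts D = {}"
    if "C \<in> components ?K" "D \<in> components ?K" "C \<noteq> D" for C D
    using that K.scc_disj unfolding eq by blast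
  show "inj_on min_label (components ?K)"
  proof (rule inj_onI)
    fix C D assume CD: "C \<in> components ?K" "D \<in> components ?K" "min_label C = min_label D"
    have "min_label X \<in> verts X" if "X \<in> components ?K" for X
    proof -
      have "X \<in> K.sccs" using that eq by simp
      then have "verts X \<noteq> {}" "verts X \<subseteq> U"
        by (auto simp: K.sccs_def strongly_connected_def induced_subgraph_def subgraph_def)
      moreover have "finite U" using K.finite_verts by simp
      ultimately show ?thesis unfolding min_label_def by (meson Min_in finite_subset)
    qed
    then show "C = D" using CD disj by (metis disjoint_iff)
  qed
qed

lemma induced_word_components:
  assumes "\<Gamma> \<in> connected_subgraphs G" "U \<subseteq> verts \<Gamma>"
  shows "set (induced_word \<Gamma> U) = components (\<Gamma> \<restriction> U)"
    and "sorted_wrt (\<lambda>C D. min_label C < min_label D) (induced_word \<Gamma> U)"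
    and "induced_word \<Gamma> U \<in> words G"
    and "word_order (induced_word \<Gamma> U) = card U"
proof -
  let ?S = "components (\<Gamma> \<restriction> U)"
  note S = components_induce[OF assms]
  show set: "set (induced_word \<Gamma> U) = ?S"
    using S(2,5) by (simp add: induced_word_def image_image)
  have "map min_label (induced_word \<Gamma> U) = sorted_list_of_set (min_label ` ?S)"
    unfolding induced_word_def map_map
    by (rule map_idI) (use S(2) in \<open>simp add: f_inv_into_f\<close>)
  then have "sorted_wrt (<) (map min_label (induced_word \<Gamma> U))"
    by simp
  then show sorted: "sorted_wrt (\<lambda>C D. min_label C < min_label D) (induced_word \<Gamma> U)"
    by (simp add: sorted_wrt_map)
  show "induced_word \<Gamma> U \<in> words G"
    using set S(1) by (auto simp: words_def)
  have "distinct (map min_label (induced_word \<Gamma> U))"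
    using \<open>sorted_wrt (<) _\<close> strict_sorted_iff by blast
  then have "distinct (induced_word \<Gamma> U)" by (simp add: distinct_map)
  then have "word_order (induced_word \<Gamma> U) = (\<Sum>C\<in>?S. card (verts C))"
    by (simp add: word_order_def sum_list_distinct_conv_sum_set set)
  also have "\<dots> = card (\<Union>C\<in>?S. verts C)"
  proof (rule card_UN_disjoint[symmetric])
    show "\<forall>C\<in>?S. finite (verts C)"
      using S(1) by (auto simp: connected_subgraphs_def dest!: subsetD
          intro!: fin_digraph.finite_verts digraph.axioms graph.axioms)
  qed (use S in auto)
  finally show "word_order (induced_word \<Gamma> U) = card U" by (simp add: S(3))
qed

lemma dual_basis_single:
  assumes "F' \<in> words G"
  shows "dual_basis G F (Poly_Mapping.single F' 1) = (if F' = F then 1 else 0)"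
  using assms by (auto simp: dual_basis_def free_module_def lookup_single when_def)

lemma lookup_scale [simp]: "Poly_Mapping.lookup (scale c x) k = c * Poly_Mapping.lookup x k"
  by (simp add: scale_def map.rep_eq when_def)

lemma dual_basis_in_graded_dual:
  fixes F :: "'b word"
  assumes "F \<in> words G"
  shows "(dual_basis G F :: ('b, 'k::comm_ring_1) word_module \<Rightarrow> 'k) \<in> graded_dual G"
proof -
  have add: "x + y \<in> free_module G" if "x \<in> free_module G" "y \<in> free_module G"
    for x y :: "('b, 'k) word_module"
    using that Poly_Mapping.keys_add[of x y] by (auto simp: free_module_def)
  have scale: "scale c x \<in> free_module G" if "x \<in> free_module G" for c and x :: "('b, 'k) word_module"
    using that by (force simp: free_module_def in_keys_iff)
  have "(dual_basis G F :: ('b, 'k) word_module \<Rightarrow> 'k) \<in> linear_forms G"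
    by (auto simp: linear_forms_def dual_basis_def add scale lookup_add)
  moreover have "{n. \<exists>x\<in>free_module_degree G n. dual_basis G F (x :: ('b, 'k) word_module) \<noteq> 0} \<subseteq> {word_order F}"
    by (auto simp: free_module_degree_def dual_basis_def free_module_def in_keys_iff subset_iff
        restrict_def)
  ultimately show ?thesis
    by (auto simp: graded_dual_def intro: finite_subset)
qed

end

theory Submission
  imports Defs
begin

text \<open>
  Evaluating \<open>Z\<^bsub>F\<^sub>1\<^esub> \<otimes> Z\<^bsub>F\<^sub>2\<^esub>\<close> at a tensor reads off the coefficient at \<open>F\<^sub>1 \<otimes> F\<^sub>2\<close>, which in the
  coproduct of a word is the number of occurrences. The sum over all words is finite because the
  coproduct preserves the number of vertices, and each letter of a word has at least one vertex.
\<close>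

text \<open>Compatibility forces a subgraph to share the tail and head maps of \<open>G\<close>, so
  it is determined by its vertex and arc sets, both drawn from finite power sets.\<close>

lemma finite_connected_subgraphs:
  assumes "graph G"
  shows "finite (connected_subgraphs G)"
proof -
  interpret graph G by fact
  have "connected_subgraphs G \<subseteq>
      (\<lambda>(V, A). \<lparr>verts = V, arcs = A, tail = tail G, head = head G\<rparr>) ` (Pow (verts G) \<times> Pow (arcs G))"
  proof
    fix H assume "H \<in> connected_subgraphs G"
    then have "subgraph H G" by (simp add: connected_subgraphs_def)
    then have "H = \<lparr>verts = verts H, arcs = arcs H, tail = tail G, head = head G\<rparr>"
      "verts H \<subseteq> verts G" "arcs H \<subseteq> arcs G"
      by (auto simp: subgraph_def compatible_def)
    then show "H \<in> (\<lambda>(V, A). \<lparr>verts = V, arcs = A, tail = tail G, head = head G\<rparr>) `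
        (Pow (verts G) \<times> Pow (arcs G))"
      by force
  qed
  then show ?thesis by (rule finite_subset) simp
qed

lemma connected_subgraph_verts:
  assumes "\<Gamma> \<in> connected_subgraphs G"
  shows "finite (verts \<Gamma>)" and "verts \<Gamma> \<noteq> {}"
proof -
  from assms have "graph \<Gamma>" "connected \<Gamma>" by (auto simp: connected_subgraphs_def)
  then interpret graph \<Gamma> by simp
  show "finite (verts \<Gamma>)" by simp
  show "verts \<Gamma> \<noteq> {}"
    using \<open>connected \<Gamma>\<close> by (auto simp: connected_def strongly_connected_def)
qed

lemma word_order_append: "word_order (A @ B) = word_order A + word_order B"
  by (simp add: word_order_def)

lemma word_order_Cons: "word_order (\<Gamma> # F) = card (verts \<Gamma>) + word_order F"
  by (simp add: word_order_def)

lemma length_le_word_order: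
  assumes "F \<in> words G"
  shows "length F \<le> word_order F"
  using assms
proof (induction F)
  case (Cons \<Gamma> F)
  then have "\<Gamma> \<in> connected_subgraphs G" "F \<in> words G" by (auto simp: words_def)
  then have "card (verts \<Gamma>) > 0" by (simp add: card_gt_0_iff connected_subgraph_verts[of _ G])
  then show ?case using Cons.IH[OF \<open>F \<in> words G\<close>] by (simp add: word_order_def)
qed (simp add: word_order_def)

text \<open>The alphabet is finite, and the order bounds the length of a word.\<close>

lemma finite_words_of_order:
  assumes "graph G"
  shows "finite {F \<in> words G. word_order F = n}"
proof (rule finite_subset)
  show "{F \<in> words G. word_order F = n} \<subseteq> {F. set F \<subseteq> connected_subgraphs G \<and> length F \<le> n}"
    using length_le_word_order by (fastforce simp: words_def)
  show "finite {F. set F \<subseteq> connected_subgraphs G \<and> length F \<le> n}"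
    using finite_connected_subgraphs[OF assms] by (rule finite_lists_length_le)
qed

lemma finite_listset: "(\<And>A. A \<in> set As \<Longrightarrow> finite A) \<Longrightarrow> finite (listset As)"
proof (induction As)
  case (Cons A As)
  \<comment> \<open>Writing the set as an image of a binary product lets finiteness pass through the
    induction.\<close>
  have "listset (A # As) = (\<lambda>(x, xs). x # xs) ` (A \<times> listset As)"
    by (auto simp: set_Cons_def)
  then show ?case using Cons by simp
qed simp

lemma finite_coproduct_indices:
  assumes "F \<in> words G"
  shows "finite (coproduct_indices F)"
proof -
  have "finite (vertex_splits \<Gamma>)" if "\<Gamma> \<in> connected_subgraphs G" for \<Gamma>
  proof (rule finite_subset)
    show "vertex_splits \<Gamma> \<subseteq> Pow (verts \<Gamma>) \<times> Pow (verts \<Gamma>)" by (auto simp: vertex_splits_def)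
  qed (use connected_subgraph_verts[OF that] in simp)
  then show ?thesis
    using assms by (auto simp: coproduct_indices_def words_def intro!: finite_listset)
qed

text \<open>Induction on the letters: each split cuts the vertex set of one letter into two blocks,
  and an induced word has as many vertices as its block. Closure under \<open>words G\<close> is
  carried along, since the dual basis is only controlled there.\<close>

lemma coproduct_term_graded:
  assumes "F \<in> words G" and "ps \<in> coproduct_indices F" and "coproduct_term F ps = (A, B)"
  shows "A \<in> words G \<and> B \<in> words G \<and> word_order A + word_order B = word_order F"
  using assms
proof (induction F arbitrary: ps A B)
  case Nil
  then show ?case by (auto simp: coproduct_term_def words_def word_order_def)
next
  case (Cons \<Gamma> F)
  from Cons.prems(1) have \<Gamma>: "\<Gamma> \<in> connected_subgraphs G" and F: "F \<in> words G"
    by (auto simp: words_def)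
  from Cons.prems(2) obtain U V qs where ps: "ps = (U, V) # qs"
    and UV: "U \<union> V = verts \<Gamma>" "U \<inter> V = {}" and qs: "qs \<in> coproduct_indices F"
    by (auto simp: coproduct_indices_def set_Cons_def vertex_splits_def)
  obtain A' B' where q: "coproduct_term F qs = (A', B')" by fastforce
  have AB: "A = induced_word \<Gamma> U @ A'" "B = induced_word \<Gamma> V @ B'"
    using Cons.prems(3) q by (auto simp: ps coproduct_term_def)
  have "U \<subseteq> verts \<Gamma>" "V \<subseteq> verts \<Gamma>" using UV by auto
  then have induced: "induced_word \<Gamma> U \<in> words G" "induced_word \<Gamma> V \<in> words G"
      "word_order (induced_word \<Gamma> U) = card U" "word_order (induced_word \<Gamma> V) = card V"
    using induced_word_components(3,4)[OF \<Gamma>] by blast+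
  have IH: "A' \<in> words G" "B' \<in> words G" "word_order A' + word_order B' = word_order F"
    using Cons.IH[OF F qs q] by blast+
  have "card U + card V = card (verts \<Gamma>)"
    using UV connected_subgraph_verts(1)[OF \<Gamma>] by (metis card_Un_disjoint finite_Un)
  then have "word_order A + word_order B = word_order (\<Gamma> # F)"
    using IH(3) induced(3,4) by (simp add: AB word_order_append word_order_Cons)
  moreover have "A \<in> words G" "B \<in> words G"
    using IH(1,2) induced(1,2) by (simp_all add: AB words_def)
  ultimately show ?case by simp
qed

lemma occurrences_nonzeroD:
  assumes "F \<in> words G" and "occurrences A B F \<noteq> 0"
  shows "A \<in> words G" and "B \<in> words G" and "word_order A + word_order B = word_order F"
proof -
  have "{ps \<in> coproduct_indices F. coproduct_term F ps = (A, B)} \<noteq> {}"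
    using assms(2) unfolding occurrences_def by (intro notI) simp
  then show "A \<in> words G" "B \<in> words G" "word_order A + word_order B = word_order F"
    using coproduct_term_graded[OF assms(1)] by blast+
qed

lemma finite_occurrences:
  assumes "graph G"
  shows "finite {F \<in> words G. occurrences A B F \<noteq> 0}"
proof (rule finite_subset)
  show "{F \<in> words G. occurrences A B F \<noteq> 0} \<subseteq>
      {F \<in> words G. word_order F = word_order A + word_order B}"
    using occurrences_nonzeroD(3)[symmetric] by blast
qed (rule finite_words_of_order[OF assms])

text \<open>Different families of splits may yield the same pair, and each adds 1 to its
  coefficient. The count is read in \<open>'k\<close>, where it may vanish although the natural
  number does not.\<close>

lemma lookup_coproduct_word:
  assumes "F \<in> words G"
  shows "Poly_Mapping.lookup (coproduct_word F :: ('b, 'k::comm_ring_1) word_tensor) (A, B) =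
    of_nat (occurrences A B F)"
proof -
  let ?I = "coproduct_indices F"
  have "Poly_Mapping.lookup (coproduct_word F :: ('b, 'k) word_tensor) (A, B) =
      (\<Sum>ps\<in>?I. if coproduct_term F ps = (A, B) then 1 else 0)"
    by (simp add: coproduct_word_def lookup_sum lookup_single when_def)
  also have "\<dots> = (\<Sum>ps | ps \<in> ?I \<and> coproduct_term F ps = (A, B). 1)"
    using finite_coproduct_indices[OF assms] by (rule sum.inter_filter[symmetric])
  also have "\<dots> = of_nat (occurrences A B F)"
    by (simp only: occurrences_def sum_constant mult_1_right)
  finally show ?thesis .
qed

lemma lookup_coproduct:
  assumes "x \<in> free_module G"
  shows "Poly_Mapping.lookup (coproduct x) (A, B) =
    (\<Sum>F\<in>Poly_Mapping.keys x. of_nat (occurrences A B F) * Poly_Mapping.lookup x F)"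
  unfolding coproduct_def lookup_sum
  by (rule sum.cong) (use assms in \<open>auto simp: free_module_def lookup_coproduct_word mult.commute\<close>)

text \<open>The forms \<open>dual_basis G F\<close> are \<open>undefined\<close> off
  \<open>free_module G\<close>, so evaluating them on the tensor factors requires both factors to be
  words over \<open>G\<close>.\<close>

lemma keys_coproduct:
  assumes "x \<in> free_module G"
  shows "Poly_Mapping.keys (coproduct x) \<subseteq> words G \<times> words G"
proof clarify
  fix A B assume "(A, B) \<in> Poly_Mapping.keys (coproduct x)"
  then have "(\<Sum>F\<in>Poly_Mapping.keys x. of_nat (occurrences A B F) * Poly_Mapping.lookup x F) \<noteq> 0"
    by (simp add: in_keys_iff lookup_coproduct[OF assms])
  then obtain F where F: "F \<in> Poly_Mapping.keys x"
    and "of_nat (occurrences A B F) * Poly_Mapping.lookup x F \<noteq> 0"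
    by (rule sum.not_neutral_contains_not_neutral)
  \<comment> \<open>Zero occurrences would make the product zero; this direction holds in any
    characteristic.\<close>
  then have "occurrences A B F \<noteq> 0" by (metis mult_zero_left of_nat_0)
  then show "A \<in> words G \<and> B \<in> words G"
    using F assms occurrences_nonzeroD[of F G A B] by (auto simp: free_module_def)
qed

text \<open>On pairs of words the product of the two values is a Kronecker delta, so at most one
  summand survives.\<close>

lemma tensor_form_dual_basis:
  fixes t :: "('b, 'k::comm_ring_1) word_tensor"
  assumes "Poly_Mapping.keys t \<subseteq> words G \<times> words G"
  shows "tensor_form (dual_basis G F1) (dual_basis G F2) t = Poly_Mapping.lookup t (F1, F2)"
proof -
  have "tensor_form (dual_basis G F1) (dual_basis G F2) t =
      (\<Sum>p\<in>Poly_Mapping.keys t. if p = (F1, F2) then Poly_Mapping.lookup t (F1, F2) else 0)"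
    unfolding tensor_form_def
    by (rule sum.cong) (auto simp: dual_basis_single dest!: subsetD[OF assms] split: if_splits)
  \<comment> \<open>If the pair is not a key, the sum is empty of it and the coefficient is zero as
    well.\<close>
  then show ?thesis by (simp add: in_keys_iff)
qed

theorem theorem3p7:
  fixes G :: "(nat, 'b) pre_digraph"
    and F1 F2 :: "(nat, 'b) pre_digraph list"
  assumes "graph G" and "verts G = {} \<or> connected G"
    and "F1 \<in> words G" and "F2 \<in> words G"
  shows "finite {F \<in> words G. occurrences F1 F2 F \<noteq> 0} \<and>
    dual_mult G (dual_basis G F1) (dual_basis G F2) =
      (\<lambda>x\<in>free_module G. \<Sum>F | F \<in> words G \<and> occurrences F1 F2 F \<noteq> 0.
         of_nat (occurrences F1 F2 F) * (dual_basis G F x :: 'k::comm_ring_1))"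
proof
  show fin: "finite {F \<in> words G. occurrences F1 F2 F \<noteq> 0}"
    using assms(1) by (rule finite_occurrences)
  show "dual_mult G (dual_basis G F1) (dual_basis G F2) =
      (\<lambda>x\<in>free_module G. \<Sum>F | F \<in> words G \<and> occurrences F1 F2 F \<noteq> 0.
         of_nat (occurrences F1 F2 F) * (dual_basis G F x :: 'k))"
    unfolding dual_mult_def
  \<comment> \<open>Both sides are extensional on \<open>free_module G\<close>, so comparing their
    values there suffices.\<close>
  proof (rule restrict_ext)
    fix x :: "('b, 'k) word_module" assume x: "x \<in> free_module G"
    have "tensor_form (dual_basis G F1) (dual_basis G F2) (coproduct x) =
        (\<Sum>F\<in>Poly_Mapping.keys x. of_nat (occurrences F1 F2 F) * Poly_Mapping.lookup x F)"
      by (simp only: tensor_form_dual_basis[OF keys_coproduct[OF x]] lookup_coproduct[OF x])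
    also have "\<dots> = (\<Sum>F | F \<in> words G \<and> occurrences F1 F2 F \<noteq> 0.
        of_nat (occurrences F1 F2 F) * dual_basis G F x)"
      \<comment> \<open>Neither index set need contain the other: a key of \<open>x\<close> outside
        the right-hand set has zero occurrences, and a word that is not a key of \<open>x\<close>
        has zero coefficient. On the common part the summands agree.\<close>
      by (rule sum.mono_neutral_cong)
        (use x fin in \<open>auto simp: dual_basis_def free_module_def in_keys_iff\<close>)
    finally show "tensor_form (dual_basis G F1) (dual_basis G F2) (coproduct x) =
        (\<Sum>F | F \<in> words G \<and> occurrences F1 F2 F \<noteq> 0.
          of_nat (occurrences F1 F2 F) * dual_basis G F x)" .
  qed
qed

end
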